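(* Let $\Delta\subseteq\mathbb{R}^d$ and, for $i\in\{1,\ldots,r\}$ with $r\ge 1$, let $g_i:\mathbb{R}^n\times\Delta\to\mathbb{R}$ be given by $$g_i(x,\delta)=\delta^\top A_i(x)\,\delta+b_i(x)^\top\delta+c_i(x),$$ where $A_i:\mathbb{R}^n\to\mathbb{R}^{d\times d}$ (without loss of generality $A_i(x)=A_i(x)^\top$), $b_i:\mathbb{R}^n\to\mathbb{R}^d$ and $c_i:\mathbb{R}^n\to\mathbb{R}$. Let $g(x,\delta)=\max_{i\in\{1,\ldots,r\}}g_i(x,\delta)$, and suppose the standing regularity assumption (see context) holds for $g$. Then the scenario program $\mathrm{SP}[\omega]$ with constraint function $g$ satisfies $$|\mathrm{sc}(\mathrm{SP}[\omega])|\le \zeta^{\mathrm{quad}}:=\frac{rd(d+3)}{2}+r$$ almost surely.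
   Context: Setting. $\delta$ is a random variable on a probability space $(\Delta,\mathcal{F},\mathbb{P})$ with $\Delta\subseteq\mathbb{R}^d$; $\mathcal{X}\subset\mathbb{R}^n$ is a compact convex set; $c\in\mathbb{R}^n$. Given a multi-sample $\omega=\{\delta^{(1)},\ldots,\delta^{(N)}\}\in\Delta^N$ of i.i.d. samples drawn according to $\mathbb{P}$, the scenario program is $$\mathrm{SP}[\omega]:\quad \min_{x\in\mathcal{X}} c^\top x \quad\text{s.t.}\quad g(x,\delta^{(j)})\le 0\ \ \forall j\in\{1,\ldots,N\}.$$ Standing regularity assumption. For almost all $\delta\in\Delta$, the function $x\mapsto g(x,\delta)$ is convex and lower semi-continuous. For any integer $N$, $\mathrm{SP}[\omega]$ is almost surely feasible, and its optimizer exists and is unique for almost all $\omega\in\Delta^N$. For all $x\in\mathcal{X}$, the mapping $\delta\mapsto g(x,\delta)$ is measurable. Support constraints. Let $x^\star$ be the minimizer of $\mathrm{SP}[\omega]$ and, for $k\in\{1,\ldots,N\}$, let $x_k^\star$ be the minimizer of $\mathrm{SP}[\omega\setminus\{\delta^{(k)}\}]$ (the program with the $k$-th sample removed). The sample $\delta^{(k)}$ is called a support sample if $c^\top x_k^\star<c^\top x^\star$; in this case the corresponding constraint $g(\cdot,\delta^{(k)})$ is called a support constraint for $\mathrm{SP}[\omega]$. $\mathrm{sc}(\mathrm{SP}[\omega])$ denotes the set of support constraints and $|\mathrm{sc}(\mathrm{SP}[\omega])|$ its cardinality. "Almost surely" refers to the random draw of $\omega\in\Delta^N$. *)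

theory Defs
  imports "HOL-Probability.Probability"
begin

definition lower_semicontinuous :: "('a::topological_space \<Rightarrow> real) \<Rightarrow> bool" where
  "lower_semicontinuous f \<longleftrightarrow> (\<forall>x. \<forall>y < f x. \<forall>\<^sub>F z in nhds x. y < f z)"

text \<open>A multi-sample is a function \<open>\<omega>\<close> on the index set \<open>{1..N}\<close>. The scenario program is
  parametrised by the set \<open>J\<close> of indices of the samples that are enforced, so that removing the
  \<open>k\<close>-th sample means passing from \<open>J\<close> to \<open>J - {k}\<close>, also when samples are repeated.\<close>

definition SP_feasible ::
  "(real^'n) set \<Rightarrow> (real^'n \<Rightarrow> 'd \<Rightarrow> real) \<Rightarrow> nat set \<Rightarrow> (nat \<Rightarrow> 'd) \<Rightarrow> (real^'n) set" where
  "SP_feasible X g J \<omega> = {x \<in> X. \<forall>j\<in>J. g x (\<omega> j) \<le> 0}"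

definition SP_minimizer ::
  "(real^'n) set \<Rightarrow> real^'n \<Rightarrow> (real^'n \<Rightarrow> 'd \<Rightarrow> real) \<Rightarrow> nat set \<Rightarrow> (nat \<Rightarrow> 'd) \<Rightarrow> real^'n \<Rightarrow> bool" where
  "SP_minimizer X c g J \<omega> x \<longleftrightarrow> is_arg_min (\<lambda>x. c \<bullet> x) (\<lambda>x. x \<in> SP_feasible X g J \<omega>) x"

text \<open>All minimizers of one program have the same cost, so the witnesses below do not matter;
  if a minimizer does not exist (a null event under the regularity assumption), no sample counts
  as a support sample. Support constraints are identified with the indices of their samples.\<close>

definition support_constraints ::
  "(real^'n) set \<Rightarrow> real^'n \<Rightarrow> (real^'n \<Rightarrow> 'd \<Rightarrow> real) \<Rightarrow> nat \<Rightarrow> (nat \<Rightarrow> 'd) \<Rightarrow> nat set" where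
  "support_constraints X c g N \<omega> =
     {k \<in> {1..N}. \<exists>x xk. SP_minimizer X c g {1..N} \<omega> x \<and>
                         SP_minimizer X c g ({1..N} - {k}) \<omega> xk \<and> c \<bullet> xk < c \<bullet> x}"

definition scenario_regular ::
  "'d measure \<Rightarrow> (real^'n) set \<Rightarrow> real^'n \<Rightarrow> (real^'n \<Rightarrow> 'd \<Rightarrow> real) \<Rightarrow> bool" where
  "scenario_regular M X c g \<longleftrightarrow>
     (AE \<delta> in M. convex_on UNIV (\<lambda>x. g x \<delta>) \<and> lower_semicontinuous (\<lambda>x. g x \<delta>)) \<and>
     (\<forall>N\<ge>1. AE \<omega> in Pi\<^sub>M {1..N} (\<lambda>_. M). SP_feasible X g {1..N} \<omega> \<noteq> {}) \<and>
     (\<forall>N\<ge>1. AE \<omega> in Pi\<^sub>M {1..N} (\<lambda>_. M). \<exists>!x. SP_minimizer X c g {1..N} \<omega> x) \<and>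
     (\<forall>x\<in>X. (\<lambda>\<delta>. g x \<delta>) \<in> borel_measurable M)"

end

theory Submission
  imports Defs
begin

text \<open>Let \<open>x\<^sub>k\<close> be an optimizer without the support sample \<open>k\<close>. A point of the convex hull
  of the \<open>x\<^sub>k\<close> costs less than the optimum, hence violates some constraint, and it can only
  violate support constraints. As convex functions are continuous, Brouwer's theorem then makes the
  violations \<open>g(z, \<delta>\<^sub>k)\<close> at some \<open>z\<close> in the hull proportional to any prescribed positive vector
  \<open>p\<close>. On the other hand, at each \<open>z\<close> the \<open>\<delta>\<^sub>k\<close> are split into \<open>r\<close> classes according to the
  index attaining the maximum. The quadratic functions on \<open>\<real>\<^sup>d\<close> form a space of dimension
  \<open>D = d(d + 3)/2 + 1\<close>, so with more than \<open>r D\<close> support samples some class satisfies a nontrivial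
  linear relation, which a generic \<open>p\<close> violates.\<close>

section \<open>Linear relations and generic vectors\<close>

text \<open>Gaussian elimination, one equation at a time: a nonzero coefficient in \<open>e\<close>
  lets the unknown \<open>k0\<close> be eliminated from the other equations, so both counts drop by
  one.\<close>

lemma homogeneous_system_nontrivial_solution:
  fixes M :: "'e \<Rightarrow> 'i \<Rightarrow> 'k::field"
  assumes "finite E" "finite J" "card E < card J"
  shows "\<exists>l. (\<exists>k\<in>J. l k \<noteq> 0) \<and> (\<forall>e\<in>E. (\<Sum>k\<in>J. l k * M e k) = 0)"
  using assms
proof (induction E arbitrary: J M rule: finite_induct)
  case empty
  then have "J \<noteq> {}" by auto
  then show ?case by (intro exI[of _ "\<lambda>_. 1"]) auto
next
  case (insert e E)
  show ?case
  proof (cases "\<forall>k\<in>J. M e k = 0")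
    case True
    have "card E < card J" using insert by simp
    with insert.IH[OF \<open>finite J\<close>, of M] True show ?thesis by auto
  next
    case False
    then obtain k0 where k0: "k0 \<in> J" "M e k0 \<noteq> 0" by auto
    define J' where "J' = J - {k0}"
    have J': "finite J'" "k0 \<notin> J'" "J = insert k0 J'" "card E < card J'"
      using insert k0 by (auto simp: J'_def)
    \<comment> \<open>Row operation: the multiple of row \<open>e\<close> is the one that clears
      column \<open>k0\<close>.\<close>
    define M' where "M' = (\<lambda>e' k. M e' k - M e' k0 * M e k / M e k0)"
    obtain l where l: "\<exists>k\<in>J'. l k \<noteq> 0" "\<forall>e\<in>E. (\<Sum>k\<in>J'. l k * M' e k) = 0"
      using insert.IH[OF J'(1,4), of M'] by blast
    \<comment> \<open>Equation \<open>e\<close> forces this value of the unknown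
      \<open>k0\<close>.\<close>
    define s where "s = - (\<Sum>k\<in>J'. l k * M e k) / M e k0"
    have sum_upd: "(\<Sum>k\<in>J. (l(k0 := s)) k * M e' k) = s * M e' k0 + (\<Sum>k\<in>J'. l k * M e' k)" for e'
      using J' by (auto intro!: sum.cong)
    show ?thesis
    proof (intro exI[of _ "l(k0 := s)"] conjI ballI)
      show "\<exists>k\<in>J. (l(k0 := s)) k \<noteq> 0" using l(1) J' by auto
      fix e' assume e': "e' \<in> insert e E"
      have "s * M e' k0 + (\<Sum>k\<in>J'. l k * M e' k) = 0"
      proof (cases "e' = e")
        case True
        then show ?thesis using k0 by (simp add: s_def)
      next
        case False
        then have "0 = (\<Sum>k\<in>J'. l k * M' e' k)" using l(2) e' by simp
        also have "\<dots> = (\<Sum>k\<in>J'. l k * M e' k - (M e' k0 / M e k0) * (l k * M e k))"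
          by (rule sum.cong) (auto simp: M'_def algebra_simps)
        also have "\<dots> = (\<Sum>k\<in>J'. l k * M e' k) - (M e' k0 / M e k0) * (\<Sum>k\<in>J'. l k * M e k)"
          by (simp add: sum_subtractf sum_distrib_left)
        also have "\<dots> = s * M e' k0 + (\<Sum>k\<in>J'. l k * M e' k)"
          by (simp add: s_def)
        finally show ?thesis by simp
      qed
      then show "(\<Sum>k\<in>J. (l(k0 := s)) k * M e' k) = 0" by (simp only: sum_upd)
    qed
  qed
qed

text \<open>A vector \<open>p\<^sub>k = t\<^sup>k\<close> on the moment curve works: each relation excludes finitely many \<open>t\<close>.\<close>
lemma generic_positive_vector:
  fixes l :: "nat set \<Rightarrow> nat \<Rightarrow> real"
  assumes "finite F" and fin: "\<And>J. J \<in> F \<Longrightarrow> finite J"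
    and nz: "\<And>J. J \<in> F \<Longrightarrow> \<exists>k\<in>J. l J k \<noteq> 0"
  shows "\<exists>p. (\<forall>k. p k > 0) \<and> (\<forall>J\<in>F. (\<Sum>k\<in>J. l J k * p k) \<noteq> 0)"
proof -
  have "finite {t::real. (\<Sum>k\<in>J. l J k * t ^ k) = 0}" if J: "J \<in> F" for J
  proof -
    define m where "m = Max J"
    have Jm: "J \<subseteq> {..m}" using fin[OF J] by (auto simp: m_def)
    \<comment> \<open>Padding with zeros gives a polynomial in \<open>t\<close> with a nonzero
      coefficient.\<close>
    have eq: "(\<Sum>k\<in>J. l J k * t ^ k) = (\<Sum>k\<le>m. (if k \<in> J then l J k else 0) * t ^ k)" for t :: real
      by (rule sum.mono_neutral_cong_left) (use Jm in auto)
    show ?thesis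
      unfolding eq polyfun_finite_roots using nz[OF J] Jm by auto
  qed
  then have "finite (\<Union>J\<in>F. {t::real. (\<Sum>k\<in>J. l J k * t ^ k) = 0})"
    using \<open>finite F\<close> by blast
  then have "infinite ({0<..} - (\<Union>J\<in>F. {t::real. (\<Sum>k\<in>J. l J k * t ^ k) = 0}))"
    by (intro Diff_infinite_finite infinite_Ioi)
  then obtain t :: real where "t \<in> {0<..} - (\<Union>J\<in>F. {t::real. (\<Sum>k\<in>J. l J k * t ^ k) = 0})"
    using infinite_imp_nonempty by blast
  then show ?thesis by (intro exI[of _ "\<lambda>k. t ^ k"]) auto
qed

section \<open>Monomials of degree at most two\<close>

text \<open>These sets are the unordered pairs with repetition, a singleton standing for a pair of
  equal entries.\<close>

lemma card_subsets_size_1_or_2: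
  "card {S :: 'a::finite set. card S = 1 \<or> card S = 2} = CARD('a) * (CARD('a) + 1) div 2"
proof -
  have "{S :: 'a set. card S = 1 \<or> card S = 2}
      = {S. S \<subseteq> UNIV \<and> card S = 1} \<union> {S. S \<subseteq> UNIV \<and> card S = 2}" by auto
  also have "card \<dots> = card {S::'a set. S \<subseteq> UNIV \<and> card S = 1} + card {S::'a set. S \<subseteq> UNIV \<and> card S = 2}"
    by (rule card_Un_disjoint) auto
  also have "\<dots> = CARD('a) + (CARD('a) choose 2)"
    by (simp only: n_subsets[OF finite] choose_one)
  also have "\<dots> = CARD('a) * (CARD('a) + 1) div 2"
    by (cases "CARD('a)") (auto simp: choose_two)
  finally show ?thesis .
qed

text \<open>After adjoining a constant coordinate, the monomials of degree at most two are the products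
  of two of the \<open>d + 1\<close> coordinates, indexed below by the sets of one or two coordinates.\<close>
lemma quadratic_dependence:
  fixes v :: "'i \<Rightarrow> real^'d"
  assumes "finite J" "CARD('d) * (CARD('d) + 3) div 2 + 1 < card J"
  shows "\<exists>l. (\<exists>k\<in>J. l k \<noteq> 0) \<and>
    (\<forall>A b c. (\<Sum>k\<in>J. l k * (v k \<bullet> (A *v v k) + b \<bullet> v k + c)) = 0)"
proof -
  define e :: "'i \<Rightarrow> 'd option \<Rightarrow> real"
    where "e k a = (case a of None \<Rightarrow> 1 | Some i \<Rightarrow> v k $ i)" for k a
  define E where "E = {S :: 'd option set. card S = 1 \<or> card S = 2}"
  \<comment> \<open>The exponent is 2 on singletons, giving squares, and 1 on two-element
    sets.\<close>
  define M where "M = (\<lambda>S k. (\<Prod>a\<in>S. e k a) ^ (3 - card S))"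
  \<comment> \<open>With \<open>d + 1\<close> coordinates,
    \<open>(d + 1)(d + 2)/2 = d(d + 3)/2 + 1\<close>.\<close>
  have "card E = CARD('d) * (CARD('d) + 3) div 2 + 1"
    unfolding E_def card_subsets_size_1_or_2 by (simp add: card_UNIV_option algebra_simps)
  then have "card E < card J" using assms by simp
  then obtain l where l: "\<exists>k\<in>J. l k \<noteq> 0" and eq: "\<And>S. S \<in> E \<Longrightarrow> (\<Sum>k\<in>J. l k * M S k) = 0"
    using homogeneous_system_nontrivial_solution[of E J M] \<open>finite J\<close> by auto
  have mon: "(\<Sum>k\<in>J. l k * (e k i * e k j)) = 0" for i j
  proof -
    have "{i, j} \<in> E" by (cases "i = j") (auto simp: E_def)
    moreover have "M {i, j} k = e k i * e k j" for k
      by (cases "i = j") (auto simp: M_def power2_eq_square)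
    ultimately show ?thesis using eq[of "{i, j}"] by simp
  qed
  have c: "(\<Sum>k\<in>J. l k * c) = 0" for c
    using mon[of None None] by (simp add: e_def flip: sum_distrib_right)
  have b: "(\<Sum>k\<in>J. l k * (b \<bullet> v k)) = 0" for b
  proof -
    have "(\<Sum>k\<in>J. l k * (b \<bullet> v k)) = (\<Sum>k\<in>J. \<Sum>i\<in>UNIV. b $ i * (l k * (e k (Some i) * e k None)))"
      by (simp add: inner_vec_def e_def sum_distrib_left algebra_simps)
    also have "\<dots> = (\<Sum>i\<in>UNIV. b $ i * (\<Sum>k\<in>J. l k * (e k (Some i) * e k None)))"
      by (subst sum.swap) (simp only: sum_distrib_left)
    finally show ?thesis by (simp only: mon) simp
  qed
  have A: "(\<Sum>k\<in>J. l k * (v k \<bullet> (A *v v k))) = 0" for A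
  proof -
    have "(\<Sum>k\<in>J. l k * (v k \<bullet> (A *v v k)))
        = (\<Sum>k\<in>J. \<Sum>i\<in>UNIV. \<Sum>j\<in>UNIV. A $ i $ j * (l k * (e k (Some i) * e k (Some j))))"
      by (simp add: inner_vec_def matrix_vector_mult_def e_def sum_distrib_left algebra_simps)
    also have "\<dots> = (\<Sum>i\<in>UNIV. \<Sum>j\<in>UNIV. \<Sum>k\<in>J. A $ i $ j * (l k * (e k (Some i) * e k (Some j))))"
      by (subst sum.swap, rule sum.cong[OF refl], rule sum.swap)
    also have "\<dots> = (\<Sum>i\<in>UNIV. \<Sum>j\<in>UNIV. A $ i $ j * (\<Sum>k\<in>J. l k * (e k (Some i) * e k (Some j))))"
      by (simp only: sum_distrib_left)
    finally show ?thesis by (simp only: mon) simp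
  qed
  have "(\<Sum>k\<in>J. l k * (v k \<bullet> (A *v v k) + b \<bullet> v k + c)) = 0" for A b c
    by (simp add: distrib_left sum.distrib A b c)
  with l show ?thesis by blast
qed

section \<open>A fixed-point argument on a convex hull\<close>

text \<open>The map \<open>T\<close> below moves \<open>z\<close> towards those \<open>x k\<close> for which \<open>u k z\<close> is below average. If \<open>K\<close>
  is the set of these \<open>k\<close> at a fixed point \<open>z\<close> and \<open>K\<close> is nonempty, then \<open>z\<close> lies in the hull of
  \<open>x ` K\<close>, so that the above-average \<open>u j z\<close> all vanish, which is absurd.\<close>
lemma convex_hull_equalizer:
  fixes x :: "'i \<Rightarrow> 'a::euclidean_space" and u :: "'i \<Rightarrow> 'a \<Rightarrow> real"
  assumes "finite I" "I \<noteq> {}"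
    and cont: "\<And>k. k \<in> I \<Longrightarrow> continuous_on (convex hull (x ` I)) (u k)"
    and nonneg: "\<And>k z. k \<in> I \<Longrightarrow> 0 \<le> u k z"
    and vanish: "\<And>K j z. K \<subseteq> I \<Longrightarrow> j \<in> I - K \<Longrightarrow> z \<in> convex hull (x ` K) \<Longrightarrow> u j z = 0"
  shows "\<exists>z \<in> convex hull (x ` I). \<exists>s. \<forall>k\<in>I. u k z = s"
proof -
  define H where "H = convex hull (x ` I)"
  define avg where "avg = (\<lambda>z. (\<Sum>k\<in>I. u k z) / card I)"
  define a where "a = (\<lambda>k z. max 0 (avg z - u k z))"
  \<comment> \<open>The denominator is the total weight, 1 for \<open>z\<close> and
    \<open>a k z\<close> for each \<open>x k\<close>, so \<open>T\<close> maps the hull to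
    itself.\<close>
  define T where "T = (\<lambda>z. (z + (\<Sum>k\<in>I. a k z *\<^sub>R x k)) /\<^sub>R (1 + (\<Sum>k\<in>I. a k z)))"
  have a0: "0 \<le> a k z" for k z by (simp add: a_def)
  have sa0: "0 \<le> (\<Sum>k\<in>I. a k z)" for z by (intro sum_nonneg a0)
  have conta: "continuous_on H (a k)" if "k \<in> I" for k
    unfolding a_def avg_def using cont that \<open>finite I\<close> \<open>I \<noteq> {}\<close>
    by (intro continuous_intros) (auto simp: H_def)
  have "continuous_on H T"
    unfolding T_def using conta sa0
    by (intro continuous_intros) (auto simp: add_nonneg_eq_0_iff)
  moreover have "T z \<in> H" if z: "z \<in> H" for z
  proof -
    define w where "w = (\<lambda>k. a k z / (1 + (\<Sum>k\<in>I. a k z)))"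
    have pos: "0 < 1 + (\<Sum>k\<in>I. a k z)" using sa0[of z] by linarith
    have T_eq: "T z = (\<Sum>k\<in>insert None (Some ` I).
        (case k of None \<Rightarrow> 1 / (1 + (\<Sum>k\<in>I. a k z)) | Some k \<Rightarrow> w k) *\<^sub>R
        (case k of None \<Rightarrow> z | Some k \<Rightarrow> x k))"
      using \<open>finite I\<close>
      by (simp add: T_def w_def sum.reindex scaleR_add_right scaleR_sum_right divide_inverse_commute)
    show ?thesis unfolding T_eq
    proof (rule convex_sum)
      show "convex H" by (simp add: H_def)
      have "(\<Sum>k\<in>I. w k) = (\<Sum>k\<in>I. a k z) / (1 + (\<Sum>k\<in>I. a k z))"
        by (simp add: w_def sum_divide_distrib)
      then show "(\<Sum>k\<in>insert None (Some ` I).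
          (case k of None \<Rightarrow> 1 / (1 + (\<Sum>k\<in>I. a k z)) | Some k \<Rightarrow> w k)) = 1"
        using \<open>finite I\<close> pos by (simp add: sum.reindex flip: add_divide_distrib)
    qed (use \<open>finite I\<close> z pos a0 in \<open>auto simp: w_def H_def hull_inc\<close>)
  qed
  moreover have "compact H" "convex H" "H \<noteq> {}"
    using \<open>finite I\<close> \<open>I \<noteq> {}\<close> by (auto simp: H_def finite_imp_compact_convex_hull)
  ultimately obtain z where z: "z \<in> H" "T z = z"
    using brouwer[of H T] by (metis Pi_I)
  define K where "K = {k \<in> I. u k z < avg z}"
  have aK: "a k z > 0" if "k \<in> K" for k using that by (simp add: a_def K_def)
  have aK': "a k z = 0" if "k \<in> I - K" for k using that by (auto simp: a_def K_def)
  have KI: "K \<subseteq> I" "finite K" using \<open>finite I\<close> by (auto simp: K_def)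
  have card_pos: "0 < card I" using \<open>finite I\<close> \<open>I \<noteq> {}\<close> by (simp add: card_gt_0_iff)
  have sum_avg: "(\<Sum>k\<in>I. u k z - avg z) = 0"
    using card_pos by (simp add: sum_subtractf avg_def)
  have "K = {}"
  proof (rule ccontr)
    assume "K \<noteq> {}"
    define S where "S = (\<Sum>k\<in>K. a k z)"
    have S: "S > 0" unfolding S_def using aK KI \<open>K \<noteq> {}\<close> by (intro sum_pos) auto
    have S1: "(\<Sum>k\<in>I. a k z) = S" unfolding S_def
      by (rule sum.mono_neutral_right) (use KI aK' \<open>finite I\<close> in auto)
    have S2: "(\<Sum>k\<in>I. a k z *\<^sub>R x k) = (\<Sum>k\<in>K. a k z *\<^sub>R x k)"
      by (rule sum.mono_neutral_right) (use KI aK' \<open>finite I\<close> in auto)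
    \<comment> \<open>In the fixed-point equation the lone \<open>z\<close> cancels, which leaves
      \<open>z\<close> as a weighted mean over \<open>K\<close> alone.\<close>
    have "z = (z + (\<Sum>k\<in>K. a k z *\<^sub>R x k)) /\<^sub>R (1 + S)"
      using z(2) by (simp add: T_def S1 S2)
    then have "(1 + S) *\<^sub>R z = (1 + S) *\<^sub>R ((z + (\<Sum>k\<in>K. a k z *\<^sub>R x k)) /\<^sub>R (1 + S))"
      by simp
    also have "\<dots> = z + (\<Sum>k\<in>K. a k z *\<^sub>R x k)" using S by simp
    finally have "S *\<^sub>R z = (\<Sum>k\<in>K. a k z *\<^sub>R x k)" by (simp add: scaleR_add_left)
    then have "z = (\<Sum>k\<in>K. a k z *\<^sub>R x k) /\<^sub>R S" using S
      by (metis less_numeral_extra(3) scaleR_scaleR left_inverse scaleR_one)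
    then have z_eq: "z = (\<Sum>k\<in>K. (a k z / S) *\<^sub>R x k)"
      by (simp add: scaleR_sum_right divide_inverse_commute)
    have "(\<Sum>k\<in>K. (a k z / S) *\<^sub>R x k) \<in> convex hull (x ` K)"
      by (rule convex_sum)
        (use KI S a0 in \<open>auto simp: hull_inc S_def simp flip: sum_divide_distrib\<close>)
    then have "z \<in> convex hull (x ` K)" using z_eq by simp
    then have u0: "u j z = 0" if "j \<in> I - K" for j using vanish[OF KI(1) that] by simp
    \<comment> \<open>Deviations from the average are negative on \<open>K\<close> by definition,
      and equal \<open>- avg z\<close> off \<open>K\<close>, where \<open>u\<close> vanishes; yet
      they sum to zero.\<close>
    have "(\<Sum>k\<in>I. u k z - avg z) < (\<Sum>k\<in>I. 0)"
    proof (rule sum_strict_mono_ex1[OF \<open>finite I\<close>])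
      have avg_pos: "avg z > 0"
        using \<open>K \<noteq> {}\<close> nonneg[of _ z] by (force simp: K_def intro: le_less_trans)
      show "\<forall>k\<in>I. u k z - avg z \<le> 0" using u0 avg_pos by (force simp: K_def)
      show "\<exists>k\<in>I. u k z - avg z < 0" using \<open>K \<noteq> {}\<close> by (auto simp: K_def)
    qed
    then show False using sum_avg by simp
  qed
  \<comment> \<open>No value lies below the average, so none lies above it.\<close>
  then have "\<forall>k\<in>I. 0 \<le> u k z - avg z" by (auto simp: K_def)
  then have "\<forall>k\<in>I. u k z - avg z = 0"
    using sum_avg \<open>finite I\<close> by (subst (asm) sum_nonneg_eq_0_iff) auto
  then show ?thesis using z(1) by (auto simp: H_def)
qed

section \<open>Support constraints of a fixed multi-sample\<close>

lemma card_support_constraints_max_quadratic: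
  fixes X :: "(real^'n) set" and \<omega> :: "nat \<Rightarrow> real^'d"
    and A :: "nat \<Rightarrow> real^'n \<Rightarrow> real^'d^'d"
  assumes "convex X"
    and gi: "\<And>i k x. i \<in> {1..r} \<Longrightarrow> k \<in> {1..N} \<Longrightarrow>
      gi i x (\<omega> k) = \<omega> k \<bullet> (A i x *v \<omega> k) + b i x \<bullet> \<omega> k + c' i x"
    and g: "\<And>k x. k \<in> {1..N} \<Longrightarrow> g x (\<omega> k) = Max ((\<lambda>i. gi i x (\<omega> k)) ` {1..r})"
    and "r \<ge> 1"
    and conv: "\<And>k. k \<in> {1..N} \<Longrightarrow> convex_on UNIV (\<lambda>x. g x (\<omega> k))"
  shows "card (support_constraints X c g N \<omega>) \<le> r * (CARD('d) * (CARD('d) + 3) div 2 + 1)"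
proof (rule ccontr)
  define D where "D = CARD('d) * (CARD('d) + 3) div 2 + 1"
  define I where "I = support_constraints X c g N \<omega>"
  assume "\<not> ?thesis"
  then have big: "r * D < card I" by (simp add: I_def D_def)
  have IN: "I \<subseteq> {1..N}" by (auto simp: I_def support_constraints_def)
  then have finI: "finite I" using finite_subset by blast
  have "I \<noteq> {}" using big by auto
  then obtain x where x: "SP_minimizer X c g {1..N} \<omega> x"
    by (auto simp: I_def support_constraints_def)
  \<comment> \<open>Each support sample may come with its own minimizer; as minimizers share one
    cost, a single \<open>x\<close> serves all \<open>k\<close>.\<close>
  have "\<exists>xk. SP_minimizer X c g ({1..N} - {k}) \<omega> xk \<and> c \<bullet> xk < c \<bullet> x" if k: "k \<in> I" for k
  proof -
    obtain x' xk where "SP_minimizer X c g {1..N} \<omega> x'"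
      "SP_minimizer X c g ({1..N} - {k}) \<omega> xk" "c \<bullet> xk < c \<bullet> x'"
      using k by (auto simp: I_def support_constraints_def)
    moreover from this(1) x have "c \<bullet> x' = c \<bullet> x"
      by (auto simp: SP_minimizer_def is_arg_min_def not_less intro: antisym)
    ultimately show ?thesis by auto
  qed
  then obtain xk where xk: "\<And>k. k \<in> I \<Longrightarrow> SP_minimizer X c g ({1..N} - {k}) \<omega> (xk k)"
    and cost: "\<And>k. k \<in> I \<Longrightarrow> c \<bullet> xk k < c \<bullet> x"
    by metis
  have xkX: "xk k \<in> X" if "k \<in> I" for k
    using xk[OF that] by (auto simp: SP_minimizer_def is_arg_min_def SP_feasible_def)
  have hull_X: "z \<in> X" "c \<bullet> z < c \<bullet> x" if z: "z \<in> convex hull (xk ` I)" for z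
  proof -
    have "convex hull (xk ` I) \<subseteq> X"
      by (rule hull_minimal) (use xkX \<open>convex X\<close> in auto)
    then show "z \<in> X" using z by auto
    have "convex hull (xk ` I) \<subseteq> {z. c \<bullet> z < c \<bullet> x}"
      by (rule hull_minimal) (use cost convex_halfspace_lt in auto)
    then show "c \<bullet> z < c \<bullet> x" using z by auto
  qed
  \<comment> \<open>For \<open>k\<close> in \<open>K\<close>, \<open>xk k\<close> satisfies
    constraint \<open>j\<close>, since only sample \<open>k\<close> was dropped; this passes to the
    hull because sublevel sets of convex functions are convex.\<close>
  have hull_le: "g z (\<omega> j) \<le> 0"
    if "K \<subseteq> I" "j \<in> {1..N} - K" "z \<in> convex hull (xk ` K)" for K j z
  proof -
    have "convex {x. g x (\<omega> j) \<le> 0}"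
      unfolding convex_def
    proof clarsimp
      fix x y and v w :: real
      assume *: "g x (\<omega> j) \<le> 0" "g y (\<omega> j) \<le> 0" "0 \<le> v" "0 \<le> w" "v + w = 1"
      have "g (v *\<^sub>R x + w *\<^sub>R y) (\<omega> j) \<le> v * g x (\<omega> j) + w * g y (\<omega> j)"
        using conv[of j] that * by (auto simp: convex_on_def)
      also have "\<dots> \<le> 0" using * by (simp add: add_nonpos_nonpos mult_nonneg_nonpos)
      finally show "g (v *\<^sub>R x + w *\<^sub>R y) (\<omega> j) \<le> 0" .
    qed
    moreover have "xk ` K \<subseteq> {x. g x (\<omega> j) \<le> 0}"
      using xk that by (force simp: SP_minimizer_def is_arg_min_def SP_feasible_def)
    ultimately have "convex hull (xk ` K) \<subseteq> {x. g x (\<omega> j) \<le> 0}"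
      by (rule hull_minimal[rotated])
    then show ?thesis using that by auto
  qed

  \<comment> \<open>The class that will be used depends on \<open>z\<close>, and \<open>z\<close>
    depends on \<open>p\<close>. So \<open>p\<close> is chosen generic for all large subsets at
    once.\<close>
  define F where "F = {J. J \<subseteq> I \<and> D < card J}"
  have "\<forall>J\<in>F. \<exists>l. (\<exists>k\<in>J. l k \<noteq> 0) \<and>
      (\<forall>A b c. (\<Sum>k\<in>J. l k * (\<omega> k \<bullet> (A *v \<omega> k) + b \<bullet> \<omega> k + c)) = 0)"
    using quadratic_dependence[of _ \<omega>] finI finite_subset[of _ I] by (auto simp: F_def D_def)
  from bchoice[OF this] obtain l where l: "\<And>J. J \<in> F \<Longrightarrow> \<exists>k\<in>J. l J k \<noteq> 0"
    and rel: "\<And>J A b c. J \<in> F \<Longrightarrow> (\<Sum>k\<in>J. l J k * (\<omega> k \<bullet> (A *v \<omega> k) + b \<bullet> \<omega> k + c)) = 0"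
    by blast
  have "finite F" "\<And>J. J \<in> F \<Longrightarrow> finite J"
    using finI finite_subset[of _ I] by (auto simp: F_def)
  from generic_positive_vector[OF this l] obtain p
    where p: "\<And>k. p k > 0" and gen: "\<And>J. J \<in> F \<Longrightarrow> (\<Sum>k\<in>J. l J k * p k) \<noteq> 0"
    by blast

  \<comment> \<open>Dividing by \<open>p k\<close> turns equal values of \<open>u\<close> into
    violations proportional to \<open>p\<close>.\<close>
  define u where "u = (\<lambda>k z. max 0 (g z (\<omega> k)) / p k)"
  have "\<exists>z \<in> convex hull (xk ` I). \<exists>s. \<forall>k\<in>I. u k z = s"
  proof (rule convex_hull_equalizer[OF finI \<open>I \<noteq> {}\<close>])
    fix k assume k: "k \<in> I"
    have "continuous_on UNIV (\<lambda>x. g x (\<omega> k))"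
      by (rule convex_on_continuous) (use k IN conv in auto)
    then have "continuous_on (convex hull (xk ` I)) (\<lambda>x. g x (\<omega> k))"
      using continuous_on_subset by blast
    then show "continuous_on (convex hull (xk ` I)) (u k)"
      unfolding u_def using p[of k] by (intro continuous_intros) auto
    show "0 \<le> u k z" for z using p[of k] by (simp add: u_def)
  next
    fix K j z assume "K \<subseteq> I" "j \<in> I - K" "z \<in> convex hull (xk ` K)"
    then show "u j z = 0" using hull_le[of K j z] IN by (auto simp: u_def max_def)
  qed
  then obtain z s where z: "z \<in> convex hull (xk ` I)" and s: "\<And>k. k \<in> I \<Longrightarrow> u k z = s" by auto
  \<comment> \<open>Otherwise \<open>z\<close> would be feasible at a cost below the
    optimum.\<close>
  have "s \<noteq> 0"
  proof
    assume "s = 0"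
    then have "g z (\<omega> k) \<le> 0" if "k \<in> I" for k
      using s[OF that] p[of k] by (auto simp: u_def max_def split: if_splits)
    moreover have "g z (\<omega> k) \<le> 0" if "k \<in> {1..N} - I" for k
      using hull_le[OF subset_refl that z] .
    ultimately have "\<forall>k\<in>{1..N}. g z (\<omega> k) \<le> 0" by blast
    then have "z \<in> SP_feasible X g {1..N} \<omega>"
      using hull_X[OF z] by (simp add: SP_feasible_def)
    then show False using x hull_X[OF z] by (auto simp: SP_minimizer_def is_arg_min_def)
  qed
  \<comment> \<open>As \<open>s\<close> is nonzero, the truncation at 0 is inactive.\<close>
  have gs: "g z (\<omega> k) = s * p k" if "k \<in> I" for k
    using s[OF that] \<open>s \<noteq> 0\<close> p[of k] by (auto simp: u_def max_def field_simps split: if_splits)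
  have "\<exists>i\<in>{1..r}. g z (\<omega> k) = gi i z (\<omega> k)" if "k \<in> I" for k
  proof -
    have "g z (\<omega> k) \<in> (\<lambda>i. gi i z (\<omega> k)) ` {1..r}"
      using g[of k z] that IN \<open>r \<ge> 1\<close> Max_in[of "(\<lambda>i. gi i z (\<omega> k)) ` {1..r}"] by auto
    then show ?thesis by auto
  qed
  then obtain m where m: "\<And>k. k \<in> I \<Longrightarrow> m k \<in> {1..r} \<and> g z (\<omega> k) = gi (m k) z (\<omega> k)"
    by metis
  \<comment> \<open>The largest class has at least \<open>card I / r\<close>, hence more than
    \<open>D\<close>, members.\<close>
  obtain i where i: "i \<in> {1..r}" "card (m -` {i} \<inter> I) * r \<ge> card I"
    using pigeonhole_card[of m I "{1..r}"] m finI \<open>r \<ge> 1\<close> by auto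
  define J where "J = m -` {i} \<inter> I"
  have "D * r < card J * r" using big i(2) unfolding J_def mult.commute[of D] by (rule less_le_trans)
  then have "J \<in> F" by (simp add: F_def J_def)
  \<comment> \<open>On \<open>J\<close> the maximum is the single quadratic function
    \<open>gi i z\<close>, so the relation for \<open>J\<close> carries over to
    \<open>p\<close>.\<close>
  have "0 = (\<Sum>k\<in>J. l J k * gi i z (\<omega> k))"
    using rel[OF \<open>J \<in> F\<close>, of "A i z" "b i z" "c' i z"] gi[OF i(1)] IN
    by (simp add: J_def subset_iff)
  also have "\<dots> = (\<Sum>k\<in>J. l J k * (s * p k))"
    by (rule sum.cong) (use m gs in \<open>auto simp: J_def\<close>)
  also have "\<dots> = s * (\<Sum>k\<in>J. l J k * p k)"
    by (simp add: sum_distrib_left algebra_simps)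
  finally show False using gen[OF \<open>J \<in> F\<close>] \<open>s \<noteq> 0\<close> by simp
qed

section \<open>Passage to random multi-samples\<close>

theorem proposition4:
  fixes \<Delta> :: "(real^'d) set" and M :: "(real^'d) measure"
    and X :: "(real^'n) set" and c :: "real^'n"
    and r N :: nat
    and A :: "nat \<Rightarrow> real^'n \<Rightarrow> real^'d^'d"
    and b :: "nat \<Rightarrow> real^'n \<Rightarrow> real^'d"
    and c' :: "nat \<Rightarrow> real^'n \<Rightarrow> real"
    and gi :: "nat \<Rightarrow> real^'n \<Rightarrow> real^'d \<Rightarrow> real"
    and g :: "real^'n \<Rightarrow> real^'d \<Rightarrow> real"
  assumes "prob_space M" and "space M = \<Delta>"
    and "compact X" and "convex X"
    and "r \<ge> 1"
    and "\<And>i x \<delta>. i \<in> {1..r} \<Longrightarrow> \<delta> \<in> \<Delta> \<Longrightarrow>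
           gi i x \<delta> = \<delta> \<bullet> (A i x *v \<delta>) + b i x \<bullet> \<delta> + c' i x"
    and "\<And>x \<delta>. \<delta> \<in> \<Delta> \<Longrightarrow> g x \<delta> = Max ((\<lambda>i. gi i x \<delta>) ` {1..r})"
    and "scenario_regular M X c g"
  shows "AE \<omega> in Pi\<^sub>M {1..N} (\<lambda>_. M).
           real (card (support_constraints X c g N \<omega>))
             \<le> real r * real CARD('d) * (real CARD('d) + 3) / 2 + real r"
proof -
  have "AE \<delta> in M. convex_on UNIV (\<lambda>x. g x \<delta>)"
    using assms(8) by (auto simp: scenario_regular_def)
  then have "AE \<omega> in Pi\<^sub>M {1..N} (\<lambda>_. M). convex_on UNIV (\<lambda>x. g x (\<omega> k))" if "k \<in> {1..N}" for k
    using that assms(1) by (intro AE_PiM_component) auto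
  then have "AE \<omega> in Pi\<^sub>M {1..N} (\<lambda>_. M). \<forall>k\<in>{1..N}. convex_on UNIV (\<lambda>x. g x (\<omega> k))"
    by (intro AE_finite_allI) auto
  \<comment> \<open>\<open>AE_space\<close> puts the samples in \<open>\<Delta>\<close>, where the
    formulas for \<open>gi\<close> and \<open>g\<close> hold.\<close>
  then show ?thesis
    using AE_space
  proof eventually_elim
    case (elim \<omega>)
    then have "\<omega> k \<in> \<Delta>" if "k \<in> {1..N}" for k
      using that assms(2) by (auto simp: space_PiM)
    then have "card (support_constraints X c g N \<omega>)
        \<le> r * (CARD('d) * (CARD('d) + 3) div 2 + 1)"
      using elim assms by (intro card_support_constraints_max_quadratic) auto
    then have "real (card (support_constraints X c g N \<omega>))
        \<le> real (r * (CARD('d) * (CARD('d) + 3) div 2 + 1))"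
      by (simp only: of_nat_le_iff)
    also have "\<dots> = real r * (real (CARD('d) * (CARD('d) + 3)) / 2 + 1)"
    proof -
      \<comment> \<open>The division is exact, since \<open>d\<close> and \<open>d + 3\<close> have
        opposite parity.\<close>
      have "even (CARD('d) * (CARD('d) + 3))" by simp
      from real_of_nat_div[OF this] show ?thesis
        by (simp only: of_nat_mult of_nat_add of_nat_1 of_nat_numeral)
    qed
    also have "\<dots> = real r * real CARD('d) * (real CARD('d) + 3) / 2 + real r"
      by (simp add: algebra_simps)
    finally show ?case .
  qed
qed

end
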